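(* Let $\boldsymbol U,\boldsymbol U_P,\boldsymbol X,\boldsymbol X_P,\boldsymbol X_+$ be the data matrices of the LPV system described in the context, with $\mathcal P$ a polytope. Let $\varepsilon_1>0$, $\sigma>1$, $\beta_1\in(0,1)$. Suppose that there exist $P\in\mathbb S^n_{++}$, $Z_0\in\mathbb R^{m\times n}$, $\bar Z\in\mathbb R^{m\times\ell n}$, $\Xi=\begin{bmatrix}\Xi_{11}&\Xi_{12} \\ \Xi_{12}^\top&\Xi_{22}\end{bmatrix}\in\mathbb S^{2\ell(4n+\mathcal T)}$ (square blocks of equal size), $\mathcal F\in\mathbb R^{\mathcal T\times n(1+\ell+\ell^2)}$ and $F_Q\in\mathbb R^{\mathcal T(1+\ell)\times n(1+\ell)}$ such that for all $p\in\mathcal P$ $$\mathcal F\begin{bmatrix} I_n \\ p\otimes I_n \\ p\otimes p\otimes I_n\end{bmatrix}=\begin{bmatrix} I_{\mathcal T} \\ p\otimes I_{\mathcal T}\end{bmatrix}^\top F_Q\begin{bmatrix} I_n \\ p\otimes I_n\end{bmatrix},$$ such that, with $K_{d0}=Z_0P^{-1}$, $\bar K_d=\bar Z(I_\ell\otimes P)^{-1}$ and $\mathcal N_{cl}=\begin{bmatrix} I_n&0&0 \\ 0&I_\ell\otimes I_n&0 \\ K_{d0}&\bar K_d&0 \\ 0&I_\ell\otimes K_{d0}&I_\ell\otimes\bar K_d\end{bmatrix}$, $$\mathcal N_{cl}\,\mathrm{Blkdiag}(P,\;I_\ell\otimes P,\;I_\ell\otimes I_\ell\otimes P)=\boldsymbol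 G\mathcal F,$$ and such that, for all $p\in\mathcal P$, $$\begin{bmatrix} M_{11}&M_{12} \\ I&0 \\ M_{21}&M_{22}\end{bmatrix}^\top\begin{bmatrix}\Xi&0 \\ 0&-\Phi\end{bmatrix}\begin{bmatrix} M_{11}&M_{12} \\ I&0 \\ M_{21}&M_{22}\end{bmatrix}\prec0,\qquad\begin{bmatrix} I \\ \Upsilon(p)\end{bmatrix}^\top\begin{bmatrix}\Xi_{11}&\Xi_{12} \\ \Xi_{12}^\top&\Xi_{22}\end{bmatrix}\begin{bmatrix} I \\ \Upsilon(p)\end{bmatrix}\succeq0,\qquad\Xi_{22}\prec0,$$ $$\begin{bmatrix} P&0&0 \\ 0&I_\ell\otimes P&0 \\ Z_0&\bar Z&0 \\ 0&I_\ell\otimes Z_0&I_\ell\otimes\bar Z\end{bmatrix}=\boldsymbol G\mathcal F .$$ Here $\Upsilon(p)=\mathrm{Blkdiag}(D_n,D_n,D_n,D_n,D_{\mathcal T})$ with $D_q=\mathrm{Diag}(p)\otimes I_q$; $M_{11}=0_{\ell(4n+\mathcal T)\times\ell(4n+\mathcal T)}$; $M_{12}=\mathrm{Blkdiag}(E_n,E_n,E_n,E_n,E_{\mathcal T})$ with $E_q=\boldsymbol 1_\ell\otimes I_q$; $M_{21}=\mathrm{Blkdiag}(L_n,L_n,L_n,L_n,L_{\mathcal T})$ with $L_q=\begin{bmatrix} 0_{q\times\ell q} \\ I_{\ell q}\end{bmatrix}$; $M_{22}=\mathrm{Blkdiag}(R_n,R_n,R_n,R_n,R_{\mathcal T})$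 with $R_q=\begin{bmatrix} I_q \\ 0_{\ell q\times q}\end{bmatrix}$; $$\Phi=\begin{bmatrix}\mathcal Y&0&(\mathcal X_+F_Q)^\top&\mathcal Y&F_Q^\top \\ 0&\sigma\mathcal Y&\mathcal Y&0&0 \\ \mathcal X_+F_Q&\mathcal Y&\bar{\mathcal Y}&0&0 \\ \mathcal Y&0&0&\beta_1^{-1}\mathcal Y&0 \\ F_Q&0&0&0&\mathcal E\end{bmatrix},$$ $\mathcal Y=\mathrm{Blkdiag}(P,0_{\ell n\times\ell n})$, $\bar{\mathcal Y}=\mathrm{Blkdiag}(P-\varepsilon_1\Delta\Delta^\top,0_{\ell n\times\ell n})$, $\mathcal E=\mathrm{Blkdiag}(\varepsilon_1I_{\mathcal T},0_{\ell\mathcal T\times\ell\mathcal T})$, $\mathcal X_+=\mathrm{Blkdiag}(\boldsymbol X_+,I_\ell\otimes\boldsymbol X_+)$, $\Delta=\sqrt{\mathcal T}\delta I_n$. Then the state-feedback controller $u_k=K_d(p_k)x_k$, $K_d(p)=K_{d0}+\sum_{i=1}^\ell p^{[i]}K_{di}$, with $$K_{d0}=Z_0P^{-1},\qquad\bar K_d=[K_{d1},\dots,K_{d\ell}]=\bar Z(I_\ell\otimes P)^{-1},$$ ensures that the closed-loop system $x_{k+1}=(A_d(p_k)+B_d(p_k)K_d(p_k))x_k+\omega_k$ is exponentially input-to-state stable (ISS).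
   Context: Notation. $\mathbb S^n$ ($\mathbb S^n_{++}$) is the set of real symmetric (symmetric positive definite) $n\times n$ matrices; $\otimes$ is the Kronecker product; $\mathrm{Col}(X_1,\dots,X_s)$ stacks its arguments vertically; $\mathrm{Blkdiag}$ forms a block-diagonal matrix (blocks may be rectangular); $\mathrm{Diag}(p)$ is the diagonal matrix with diagonal $p$; $\boldsymbol 1_\ell\in\mathbb R^\ell$ is the all-ones column vector; $p^{[i]}$ is the $i$-th entry of $p\in\mathbb R^\ell$. System. $n,m,\ell,\mathcal T$ are positive integers and $\mathcal P\subset\mathbb R^\ell$ is the set of admissible scheduling values. The LPV system is $x_{k+1}=A_d(p_k)x_k+B_d(p_k)u_k+\omega_k$, $k\in\mathbb N$, with $x_k,\omega_k\in\mathbb R^n$, $u_k\in\mathbb R^m$, $p_k\in\mathcal P$, and affine dependence $A_d(p)=A_{d0}+\sum_{i=1}^\ell p^{[i]}A_{di}$, $B_d(p)=B_{d0}+\sum_{i=1}^\ell p^{[i]}B_{di}$. Put $\mathcal A_d=[A_{d0},A_{d1},\dots,A_{d\ell}]$, $\mathcal B_d=[B_{d0},B_{d1},\dots,B_{d\ell}]$; then $x_{k+1}=\mathcal A_d\mathrm{Col}(x_k,p_k\otimes x_k)+\mathcal B_d\mathrm{Col}(u_k,p_k\otimes u_k)+\omega_k$. Perturbation assumption. There is a known $\delta>0$ such that $\|\omega_k\|\le\delta$ for all $k$ (both in the data and in closed-loop operation); in particular $\boldsymbol W\boldsymbol W^\top\preceq\Delta\Delta^\top$ with $\Delta=\sqrt{\mathcal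 T}\delta I_n$. Data. From a trajectory $\{u_k,p_k,x_k,\omega_k\}_{k=0}^{\mathcal T}$ of the system form $\boldsymbol U=[u_0,\dots,u_{\mathcal T-1}]$, $\boldsymbol U_P=[p_0\otimes u_0,\dots,p_{\mathcal T-1}\otimes u_{\mathcal T-1}]$, $\boldsymbol X=[x_0,\dots,x_{\mathcal T-1}]$, $\boldsymbol X_P=[p_0\otimes x_0,\dots,p_{\mathcal T-1}\otimes x_{\mathcal T-1}]$, $\boldsymbol X_+=[x_1,\dots,x_{\mathcal T}]$, $\boldsymbol W=[\omega_0,\dots,\omega_{\mathcal T-1}]$, so that $\boldsymbol X_+=\mathcal A_d\mathrm{Col}(\boldsymbol X,\boldsymbol X_P)+\mathcal B_d\mathrm{Col}(\boldsymbol U,\boldsymbol U_P)+\boldsymbol W$. Put $\boldsymbol G=\mathrm{Col}(\boldsymbol X,\boldsymbol X_P,\boldsymbol U,\boldsymbol U_P)$. Exponential ISS. A closed-loop system with state $x_k$ and perturbation $\omega_k$ is exponentially ISS if there exist $\alpha_1,\alpha_2>0$ and a class-$\mathcal K$ function $\gamma$ such that $\|x_k\|\le\alpha_1e^{-\alpha_2k}\|x_0\|+\gamma\big(\sup_{0\le s\le k-1}\|\omega_s\|\big)$ for all $k\in\mathbb N$, all $x_0$, all scheduling sequences in $\mathcal P$ and all admissible perturbation sequences (a supremum over the empty set is $0$). *)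

theory Defs
  imports "HOL-Analysis.Analysis"
begin

text \<open>
  Matrix dimensions are finite types: an index of type \<open>'a + 'b\<close> stands for stacking, an index of
  type \<open>'a \<times> 'b\<close> for a Kronecker product. Thus \<open>real^('l \<times> 'n)^'m\<close> is the space of
  \<open>m \<times> \<ell>n\<close> matrices, consisting of \<open>\<ell>\<close> blocks of size \<open>m \<times> n\<close> side by side.
\<close>

section \<open>Block matrices\<close>

definition hstack :: "real^'a^'r \<Rightarrow> real^'b^'r \<Rightarrow> real^('a + 'b)^'r" (infixr \<open>\<parallel>\<close> 67)
  where "A \<parallel> B = (\<chi> i j. case j of Inl a \<Rightarrow> A $ i $ a | Inr b \<Rightarrow> B $ i $ b)"

definition vstack :: "real^'c^'a \<Rightarrow> real^'c^'b \<Rightarrow> real^'c^('a + 'b)" (infixr \<open>\<Zsemi>\<close> 66)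
  where "A \<Zsemi> B = (\<chi> i. case i of Inl a \<Rightarrow> A $ a | Inr b \<Rightarrow> B $ b)"

definition blkdiag :: "real^'a^'c \<Rightarrow> real^'b^'d \<Rightarrow> real^('a + 'b)^('c + 'd)" (infixr \<open>\<oplus>\<close> 68)
  where "A \<oplus> B = (A \<parallel> 0) \<Zsemi> (0 \<parallel> B)"

text \<open>The matrix \<open>[M 1, \<dots>, M \<ell>]\<close>.\<close>

definition hcat :: "('l::finite \<Rightarrow> real^'c^'r) \<Rightarrow> real^('l \<times> 'c)^'r"
  where "hcat M = (\<chi> i j. M (fst j) $ i $ snd j)"

definition Diag :: "real^'l \<Rightarrow> real^'l^'l"
  where "Diag p = (\<chi> i j. if i = j then p $ i else 0)"


section \<open>Kronecker products\<close>

definition kron :: "real^'b^'a \<Rightarrow> real^'d^'c \<Rightarrow> real^('b \<times> 'd)^('a \<times> 'c)" (infixr \<open>\<otimes>\<close> 75)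
  where "A \<otimes> B = (\<chi> i j. A $ fst i $ fst j * B $ snd i $ snd j)"

text \<open>A column vector has a single column, so \<open>p \<otimes> A\<close> has the column index of \<open>A\<close>, and the product
  of two vectors is again a vector.\<close>

definition kron_col :: "real^'l \<Rightarrow> real^'c^'r \<Rightarrow> real^'c^('l \<times> 'r)" (infixr \<open>\<otimes>\<^sub>c\<close> 75)
  where "p \<otimes>\<^sub>c A = (\<chi> i j. p $ fst i * A $ snd i $ j)"

definition kron_vec :: "real^'l \<Rightarrow> real^'n \<Rightarrow> real^('l \<times> 'n)" (infixr \<open>\<otimes>\<^sub>v\<close> 75)
  where "p \<otimes>\<^sub>v x = (\<chi> i. p $ fst i * x $ snd i)"


section \<open>Definiteness\<close>

definition pos_def :: "real^'n^'n \<Rightarrow> bool"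
  where "pos_def A \<longleftrightarrow> transpose A = A \<and> (\<forall>x. x \<noteq> 0 \<longrightarrow> 0 < x \<bullet> (A *v x))"

definition pos_semidef :: "real^'n^'n \<Rightarrow> bool"
  where "pos_semidef A \<longleftrightarrow> transpose A = A \<and> (\<forall>x. 0 \<le> x \<bullet> (A *v x))"

definition neg_def :: "real^'n^'n \<Rightarrow> bool"
  where "neg_def A \<longleftrightarrow> pos_def (- A)"


section \<open>Linear parameter-varying systems and their data\<close>

definition affine_mat :: "real^'c^'r \<Rightarrow> ('l \<Rightarrow> real^'c^'r) \<Rightarrow> real^'l \<Rightarrow> real^'c^'r"
  where "affine_mat M0 M p = M0 + (\<Sum>i\<in>UNIV. p $ i *\<^sub>R M i)"

text \<open>The matrix \<open>[v 0, \<dots>, v (T-1)]\<close>; the bijection \<open>\<tau>\<close> from \<open>'t\<close> onto \<open>{..<T}\<close>, where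
  \<open>T = CARD('t)\<close>, numbers the columns.\<close>

definition data_mat :: "('t \<Rightarrow> nat) \<Rightarrow> (nat \<Rightarrow> real^'n) \<Rightarrow> real^'t^'n"
  where "data_mat \<tau> v = (\<chi> i j. v (\<tau> j) $ i)"


section \<open>Exponential input-to-state stability\<close>

definition class_K :: "(real \<Rightarrow> real) \<Rightarrow> bool"
  where "class_K \<gamma> \<longleftrightarrow> continuous_on {0..} \<gamma> \<and> strict_mono_on {0..} \<gamma> \<and> \<gamma> 0 = 0"

definition sup_norm_upto :: "(nat \<Rightarrow> 'a::real_normed_vector) \<Rightarrow> nat \<Rightarrow> real"
  where "sup_norm_upto w k = (if k = 0 then 0 else (SUP s\<in>{0..k - 1}. norm (w s)))"

text \<open>The system is \<open>x (k + 1) = f (p k) (x k) (w k)\<close>, with scheduling sequences in \<open>S\<close> and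
  perturbation sequences in \<open>\<Omega>\<close>.\<close>

definition exp_ISS ::
    "('p \<Rightarrow> 'x::real_normed_vector \<Rightarrow> 'w::real_normed_vector \<Rightarrow> 'x) \<Rightarrow> 'p set \<Rightarrow> 'w set \<Rightarrow> bool"
  where "exp_ISS f S \<Omega> \<longleftrightarrow>
    (\<exists>\<alpha>1>0. \<exists>\<alpha>2>0. \<exists>\<gamma>. class_K \<gamma> \<and>
      (\<forall>x p w. (\<forall>k. p k \<in> S) \<longrightarrow> (\<forall>k. w k \<in> \<Omega>) \<longrightarrow> (\<forall>k. x (Suc k) = f (p k) (x k) (w k)) \<longrightarrow>
        (\<forall>k. norm (x k) \<le> \<alpha>1 * exp (- \<alpha>2 * real k) * norm (x 0) + \<gamma> (sup_norm_upto w k))))"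


section \<open>Matrices of the synthesis conditions\<close>

type_synonym ('a, 'b) five = "'a + 'a + 'a + 'a + 'b"

definition N_cl ::
    "real^'n^'m \<Rightarrow> real^('l::finite \<times> 'n)^'m \<Rightarrow>
     real^('n + 'l \<times> 'n + 'l \<times> 'l \<times> 'n)^('n + 'l \<times> 'n + 'm + 'l \<times> 'm)"
  where "N_cl K0 K =
    (mat 1 \<parallel> 0             \<parallel> 0) \<Zsemi>
    (0     \<parallel> mat 1 \<otimes> mat 1 \<parallel> 0) \<Zsemi>
    (K0    \<parallel> K             \<parallel> 0) \<Zsemi>
    (0     \<parallel> mat 1 \<otimes> K0    \<parallel> mat 1 \<otimes> K)"

definition N_lin ::
    "real^'n^'n \<Rightarrow> real^'n^'m \<Rightarrow> real^('l::finite \<times> 'n)^'m \<Rightarrow>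
     real^('n + 'l \<times> 'n + 'l \<times> 'l \<times> 'n)^('n + 'l \<times> 'n + 'm + 'l \<times> 'm)"
  where "N_lin P Z0 Z =
    (P  \<parallel> 0          \<parallel> 0) \<Zsemi>
    (0  \<parallel> mat 1 \<otimes> P  \<parallel> 0) \<Zsemi>
    (Z0 \<parallel> Z          \<parallel> 0) \<Zsemi>
    (0  \<parallel> mat 1 \<otimes> Z0 \<parallel> mat 1 \<otimes> Z)"

definition Upsilon ::
    "real^'l \<Rightarrow> real^('l \<times> 'n::finite, 'l \<times> 't::finite) five^('l \<times> 'n, 'l \<times> 't) five"
  where "Upsilon p =
    (Diag p \<otimes> mat 1) \<oplus> (Diag p \<otimes> mat 1) \<oplus> (Diag p \<otimes> mat 1) \<oplus> (Diag p \<otimes> mat 1) \<oplus> (Diag p \<otimes> mat 1)"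

definition blk_E :: "real^'q^('l::finite \<times> 'q)"
  where "blk_E = (vec 1 :: real^'l) \<otimes>\<^sub>c mat 1"

definition blk_L :: "real^('l::finite \<times> 'q::finite)^('q + 'l \<times> 'q)"
  where "blk_L = 0 \<Zsemi> mat 1"

definition blk_R :: "real^'q^('q + 'l::finite \<times> 'q)"
  where "blk_R = mat 1 \<Zsemi> 0"

definition M11 :: "real^('l::finite \<times> 'n::finite, 'l \<times> 't::finite) five^('l \<times> 'n, 'l \<times> 't) five"
  where "M11 = 0"

definition M12 :: "real^('n::finite, 't::finite) five^('l::finite \<times> 'n, 'l \<times> 't) five"
  where "M12 = blk_E \<oplus> blk_E \<oplus> blk_E \<oplus> blk_E \<oplus> blk_E"

definition M21 :: "real^('l::finite \<times> 'n::finite, 'l \<times> 't::finite) five^('n + 'l \<times> 'n, 't + 'l \<times> 't) five"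
  where "M21 = blk_L \<oplus> blk_L \<oplus> blk_L \<oplus> blk_L \<oplus> blk_L"

definition M22 :: "real^('n::finite, 't::finite) five^('n + 'l::finite \<times> 'n, 't + 'l \<times> 't) five"
  where "M22 = blk_R \<oplus> blk_R \<oplus> blk_R \<oplus> blk_R \<oplus> blk_R"

definition Phi ::
    "real^'n^'n \<Rightarrow> real^('n + 'l::finite \<times> 'n)^('t + 'l \<times> 't) \<Rightarrow> real^'t^'n \<Rightarrow> real^'n^'n \<Rightarrow>
     real \<Rightarrow> real \<Rightarrow> real \<Rightarrow> real^('n + 'l \<times> 'n, 't + 'l \<times> 't) five^('n + 'l \<times> 'n, 't + 'l \<times> 't) five"
  where "Phi P FQ Xplus \<Delta> \<epsilon> \<sigma> \<beta> =
    (let Y = P \<oplus> (0 :: real^('l \<times> 'n)^('l \<times> 'n));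
         Ybar = (P - \<epsilon> *\<^sub>R (\<Delta> ** transpose \<Delta>)) \<oplus> (0 :: real^('l \<times> 'n)^('l \<times> 'n));
         E = (\<epsilon> *\<^sub>R mat 1 :: real^'t^'t) \<oplus> (0 :: real^('l \<times> 't)^('l \<times> 't));
         XF = (Xplus \<oplus> ((mat 1 :: real^'l^'l) \<otimes> Xplus)) ** FQ
     in (Y  \<parallel> 0          \<parallel> transpose XF \<parallel> Y                \<parallel> transpose FQ) \<Zsemi>
        (0  \<parallel> \<sigma> *\<^sub>R Y     \<parallel> Y            \<parallel> 0                \<parallel> 0) \<Zsemi>
        (XF \<parallel> Y          \<parallel> Ybar         \<parallel> 0                \<parallel> 0) \<Zsemi>
        (Y  \<parallel> 0          \<parallel> 0            \<parallel> inverse \<beta> *\<^sub>R Y   \<parallel> 0) \<Zsemi>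
        (FQ \<parallel> 0          \<parallel> 0            \<parallel> 0                \<parallel> E))"

end

theory Submission
  imports Defs
begin

text \<open>
  Restricting the first matrix inequality to the graph of \<open>Upsilon q\<close> and using the multiplier
  condition leaves \<open>\<zeta>\<^sup>T (T(q)\<^sup>T \<Phi> T(q)) \<zeta> \<ge> 0\<close>, where \<open>T(q)\<close> lifts each block by
  \<open>v \<mapsto> Col(v, q \<otimes> v)\<close>; this removes the Kronecker structure. With \<open>H\<close> the matrix given by
  \<open>F\<close> at \<open>q\<close>, the data equation gives \<open>X\<^sub>+ H = A\<^sub>c\<^sub>l(q) P + W H\<close>, and the last block variable
  \<open>e = - W\<^sup>T c\<close> eliminates the unknown perturbation data \<open>W\<close> because \<open>W W\<^sup>T \<preceq> \<Delta> \<Delta>\<^sup>T\<close>. Optimizing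
  over the remaining blocks shows that \<open>V(x) = x\<^sup>T P\<inverse> x\<close> satisfies
  \<open>V(A\<^sub>c\<^sub>l(q) x) \<le> (1 - \<beta>\<^sub>1) (1 - 1 / \<sigma>) V(x)\<close> uniformly in \<open>q\<close>; thus \<open>\<surd>V\<close> is a norm contracted by
  the closed loop.
\<close>

section \<open>Block and Kronecker matrices acting on vectors\<close>

definition vjoin :: "real^'a \<Rightarrow> real^'b \<Rightarrow> real^('a + 'b)" (infixr \<open>\<Zsemi>\<^sub>v\<close> 66)
  where "u \<Zsemi>\<^sub>v v = (\<chi> i. case i of Inl a \<Rightarrow> u $ a | Inr b \<Rightarrow> v $ b)"

lemma sum_UNIV_Plus:
  "(\<Sum>i\<in>(UNIV :: ('a::finite + 'b::finite) set). f i) = (\<Sum>i\<in>UNIV. f (Inl i)) + (\<Sum>i\<in>UNIV. f (Inr i))"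
  unfolding UNIV_Plus_UNIV[symmetric] by (subst sum.Plus) auto

lemma sum_UNIV_Times:
  "(\<Sum>i\<in>(UNIV :: ('a::finite \<times> 'b::finite) set). f i) = (\<Sum>i\<in>UNIV. \<Sum>j\<in>UNIV. f (i, j))"
  using sum.cartesian_product[of "\<lambda>i j. f (i, j)" UNIV UNIV] by simp

lemma hstack_mult_vjoin: "(A \<parallel> B) *v (u \<Zsemi>\<^sub>v v) = A *v u + B *v v"
  by (simp add: vec_eq_iff matrix_vector_mult_def hstack_def vjoin_def sum_UNIV_Plus)

lemma vstack_mult_vec: "(A \<Zsemi> B) *v u = (A *v u) \<Zsemi>\<^sub>v (B *v u)"
  by (simp add: vec_eq_iff matrix_vector_mult_def vstack_def vjoin_def split: sum.split)

lemma blkdiag_mult_vjoin: "(A \<oplus> B) *v (u \<Zsemi>\<^sub>v v) = (A *v u) \<Zsemi>\<^sub>v (B *v v)"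
  by (simp add: blkdiag_def vstack_mult_vec hstack_mult_vjoin)

lemma inner_vjoin: "(u \<Zsemi>\<^sub>v v) \<bullet> (u' \<Zsemi>\<^sub>v v') = u \<bullet> u' + v \<bullet> v'"
  by (simp add: inner_vec_def vjoin_def sum_UNIV_Plus)

lemma vjoin_add: "(u \<Zsemi>\<^sub>v v) + (u' \<Zsemi>\<^sub>v v') = (u + u') \<Zsemi>\<^sub>v (v + v')"
  by (simp add: vec_eq_iff vjoin_def split: sum.split)

lemma vjoin_eq_iff: "u \<Zsemi>\<^sub>v v = u' \<Zsemi>\<^sub>v v' \<longleftrightarrow> u = u' \<and> v = v'"
  by (auto simp: vec_eq_iff vjoin_def split: sum.splits)

lemma kron_col_mult_vec: "(q \<otimes>\<^sub>c A) *v x = q \<otimes>\<^sub>v (A *v x)"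
  by (simp add: vec_eq_iff matrix_vector_mult_def kron_col_def kron_vec_def sum_distrib_left mult.assoc)

lemma kron_mult_kron_vec: "(A \<otimes> B) *v (q \<otimes>\<^sub>v x) = (A *v q) \<otimes>\<^sub>v (B *v x)"
  by (simp add: vec_eq_iff matrix_vector_mult_def kron_def kron_vec_def sum_UNIV_Times
      sum_product ac_simps)

lemma kron_vec_add: "q \<otimes>\<^sub>v (x + y) = q \<otimes>\<^sub>v x + q \<otimes>\<^sub>v y"
  by (simp add: vec_eq_iff kron_vec_def algebra_simps)

text \<open>Since \<open>blk_E\<close> sends v to 1 \<otimes> v, this makes each block of
  \<open>Upsilon q\<close> turn it into q \<otimes> v.\<close>

lemma Diag_mult_1: "Diag q *v 1 = q"
  by (simp add: vec_eq_iff matrix_vector_mult_def Diag_def)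

lemma transpose_blkdiag: "transpose (A \<oplus> B) = transpose A \<oplus> transpose B"
  by (auto simp: vec_eq_iff blkdiag_def vstack_def hstack_def transpose_def split: sum.splits)

lemma transpose_kron: "transpose (A \<otimes> B) = transpose A \<otimes> transpose B"
  by (simp add: vec_eq_iff kron_def transpose_def)

lemma kron_mult_kron: "(A \<otimes> B) ** (C \<otimes> D) = (A ** C) \<otimes> (B ** D)"
  by (simp add: vec_eq_iff matrix_matrix_mult_def kron_def sum_UNIV_Times sum_product ac_simps)

lemma kron_mat_1: "mat 1 \<otimes> mat 1 = mat 1"
  by (auto simp: vec_eq_iff kron_def mat_def)

text \<open>Affine dependence on \<open>q\<close> becomes linearity in Col(x, q \<otimes> x), so
  samples recorded at different scheduling values can be combined linearly.\<close>

lemma affine_mat_mult_vec: "affine_mat M0 M q *v x = M0 *v x + hcat M *v (q \<otimes>\<^sub>v x)"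
proof -
  have "((\<Sum>i\<in>UNIV. q $ i *\<^sub>R M i) *v x) $ r = (hcat M *v (q \<otimes>\<^sub>v x)) $ r" for r
    unfolding matrix_vector_mult_def hcat_def kron_vec_def
    by (simp add: sum_UNIV_Times sum_distrib_right) (subst sum.swap, simp add: ac_simps)
  then show ?thesis
    by (simp add: vec_eq_iff affine_mat_def matrix_vector_mult_add_rdistrib)
qed

lemma uminus_mult_vec: "(- A) *v x = - (A *v x)" for A :: "real^_^_"
  using matrix_vector_mult_diff_rdistrib[of 0 A x] by simp

lemma inner_transpose_mult: "x \<bullet> (transpose A *v y) = (A *v x) \<bullet> y" for A :: "real^_^_"
  by (metis dot_lmul_matrix inner_commute transpose_matrix_vector)

lemma inner_congruence:
  "x \<bullet> ((transpose N ** A ** N) *v y) = (N *v x) \<bullet> (A *v (N *v y))" for A N :: "real^_^_"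
  by (metis inner_transpose_mult matrix_vector_mul_assoc)

section \<open>Data matrices and the perturbation bound\<close>

lemma data_mat_mult_vec: "data_mat \<tau> v *v h = (\<Sum>j\<in>UNIV. h $ j *\<^sub>R v (\<tau> j))"
  by (simp add: vec_eq_iff data_mat_def matrix_vector_mult_def mult.commute)

text \<open>Carries the system equation, known sample by sample, over to weighted combinations of
  samples.\<close>

lemma mult_data_mat: "M *v (data_mat \<tau> v *v h) = data_mat \<tau> (\<lambda>k. M *v v k) *v h"
  by (simp add: data_mat_mult_vec linear_sum[OF matrix_vector_mul_linear]
      linear_scale[OF matrix_vector_mul_linear])

lemma transpose_data_mat_mult_vec: "transpose (data_mat \<tau> v) *v c = (\<chi> j. v (\<tau> j) \<bullet> c)"
  by (simp add: vec_eq_iff data_mat_def matrix_vector_mult_def transpose_def inner_vec_def)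

text \<open>For perturbation data this is W W^T \<preceq> T \<delta>^2 I tested at \<open>c\<close>:
  Cauchy-Schwarz bounds each of the T entries of W^T c by \<delta> times the norm of
  \<open>c\<close>.\<close>

lemma norm_transpose_data_mat_le:
  fixes \<tau> :: "'t::finite \<Rightarrow> nat"
  assumes "\<And>j. norm (v (\<tau> j)) \<le> \<delta>"
  shows "(norm (transpose (data_mat \<tau> v) *v c))\<^sup>2 \<le> real CARD('t) * \<delta>\<^sup>2 * (norm c)\<^sup>2"
proof -
  have "(norm (transpose (data_mat \<tau> v) *v c))\<^sup>2 = (\<Sum>j\<in>UNIV. (v (\<tau> j) \<bullet> c)\<^sup>2)"
    unfolding transpose_data_mat_mult_vec power2_norm_eq_inner
    by (simp add: inner_vec_def power2_eq_square)
  also have "\<dots> \<le> (\<Sum>j\<in>(UNIV :: 't set). (\<delta> * norm c)\<^sup>2)"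
  proof (rule sum_mono)
    fix j
    have "\<bar>v (\<tau> j) \<bullet> c\<bar> \<le> \<delta> * norm c"
      by (meson Cauchy_Schwarz_ineq2 assms mult_right_mono norm_ge_zero order_trans)
    then show "(v (\<tau> j) \<bullet> c)\<^sup>2 \<le> (\<delta> * norm c)\<^sup>2"
      by (metis abs_ge_zero power2_abs power_mono)
  qed
  finally show ?thesis
    by (simp add: power_mult_distrib)
qed


section \<open>Positive definite matrices\<close>

lemma matrix_inv_mult:
  assumes "invertible A"
  shows "A ** matrix_inv A = mat 1" "matrix_inv A ** A = mat 1"
  using someI_ex[OF assms[unfolded invertible_def]] unfolding matrix_inv_def by auto

lemma pos_def_invertible:
  assumes "pos_def P"
  shows "invertible P"
proof -
  have "x = 0" if "P *v x = 0" for x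
    using assms that unfolding pos_def_def by (metis inner_zero_right less_irrefl)
  then show ?thesis
    by (simp add: invertible_left_inverse matrix_left_invertible_ker)
qed

text \<open>The inverse is congruent to \<open>P\<close>, namely Q = Q^T P Q, and congruence by an
  invertible matrix preserves symmetry and definiteness.\<close>

lemma pos_def_matrix_inv:
  assumes "pos_def P"
  shows "pos_def (matrix_inv P)"
proof -
  let ?Q = "matrix_inv P"
  have PQ: "P ** ?Q = mat 1" "?Q ** P = mat 1"
    using pos_def_invertible[OF assms] by (simp_all add: matrix_inv_mult)
  \<comment> \<open>The inserted factor Q^T P^T = (P Q)^T is the identity; symmetry of Q is not yet
    available here.\<close>
  have "?Q = transpose ?Q ** transpose P ** ?Q"
    by (metis PQ(1) matrix_mul_lid matrix_transpose_mul transpose_mat)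
  then have Q: "?Q = transpose ?Q ** P ** ?Q"
    using assms unfolding pos_def_def by metis
  have "transpose (transpose ?Q ** P ** ?Q) = transpose ?Q ** P ** ?Q"
    using assms by (simp add: pos_def_def matrix_transpose_mul matrix_mul_assoc)
  moreover have "0 < x \<bullet> (?Q *v x)" if "x \<noteq> 0" for x
  proof -
    have "?Q *v x \<noteq> 0"
      using that PQ(1) by (metis matrix_vector_mul_assoc matrix_vector_mul_lid matrix_vector_mult_0_right)
    moreover have "x \<bullet> (?Q *v x) = (?Q *v x) \<bullet> (P *v (?Q *v x))"
      using Q inner_congruence by metis
    ultimately show ?thesis
      using assms by (simp add: pos_def_def)
  qed
  ultimately show ?thesis
    unfolding pos_def_def using Q by metis
qed

section \<open>The norm induced by a positive definite matrix\<close>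

lemma pos_def_inner_commute: "pos_def Q \<Longrightarrow> x \<bullet> (Q *v y) = y \<bullet> (Q *v x)"
  by (metis inner_commute inner_transpose_mult pos_def_def)

lemma pos_def_nonneg: "pos_def Q \<Longrightarrow> 0 \<le> x \<bullet> (Q *v x)"
  by (cases "x = 0") (auto simp: pos_def_def less_imp_le)

text \<open>For Q = P^{-1} this is the square root of the Lyapunov function. Taking the root gives a
  triangle inequality, which handles the additive perturbation.\<close>

definition mat_norm :: "real^'n^'n \<Rightarrow> real^'n \<Rightarrow> real"
  where "mat_norm Q x = sqrt (x \<bullet> (Q *v x))"

lemma mat_norm_nonneg: "pos_def Q \<Longrightarrow> 0 \<le> mat_norm Q x"
  by (simp add: mat_norm_def pos_def_nonneg)

lemma mat_norm_sq: "pos_def Q \<Longrightarrow> (mat_norm Q x)\<^sup>2 = x \<bullet> (Q *v x)"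
  by (simp add: mat_norm_def pos_def_nonneg)

lemma mat_norm_Cauchy_Schwarz:
  assumes "pos_def Q"
  shows "x \<bullet> (Q *v y) \<le> mat_norm Q x * mat_norm Q y"
proof (cases "y = 0")
  case True
  then show ?thesis by (simp add: mat_norm_def)
next
  case False
  let ?y = "y \<bullet> (Q *v y)" and ?xy = "x \<bullet> (Q *v y)"
  have y: "?y > 0"
    using assms False by (simp add: pos_def_def)
  \<comment> \<open>The residual of projecting \<open>x\<close> onto \<open>y\<close>, scaled by
    \<open>?y\<close> to avoid division.\<close>
  have "0 \<le> (?y *\<^sub>R x - ?xy *\<^sub>R y) \<bullet> (Q *v (?y *\<^sub>R x - ?xy *\<^sub>R y))"
    using assms by (rule pos_def_nonneg)
  also have "\<dots> = ?y * (?y * (x \<bullet> (Q *v x)) - ?xy\<^sup>2)"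
    using pos_def_inner_commute[OF assms, of y x]
    by (simp add: matrix_vector_mult_diff_distrib matrix_vector_mult_scaleR inner_diff_left inner_diff_right
        algebra_simps power2_eq_square)
  finally have "?xy\<^sup>2 \<le> (mat_norm Q x * mat_norm Q y)\<^sup>2"
    using y assms by (simp add: zero_le_mult_iff power_mult_distrib mat_norm_sq mult.commute)
  then show ?thesis
    using assms by (meson mat_norm_nonneg mult_nonneg_nonneg power2_le_imp_le)
qed

lemma mat_norm_triangle:
  assumes "pos_def Q"
  shows "mat_norm Q (x + y) \<le> mat_norm Q x + mat_norm Q y"
proof (rule power2_le_imp_le)
  show "(mat_norm Q (x + y))\<^sup>2 \<le> (mat_norm Q x + mat_norm Q y)\<^sup>2"
    using mat_norm_Cauchy_Schwarz[OF assms, of x y] pos_def_inner_commute[OF assms, of y x]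
    by (simp add: mat_norm_sq[OF assms] power2_sum matrix_vector_right_distrib inner_add_left inner_add_right)
qed (simp add: assms mat_norm_nonneg)

lemma mat_norm_le_norm:
  assumes "pos_def Q"
  obtains c where "c > 0" "\<And>x. mat_norm Q x \<le> c * norm x"
proof -
  obtain B where B: "B > 0" "\<And>x. norm (Q *v x) \<le> B * norm x"
    using linear_bounded_pos[OF matrix_vector_mul_linear[of Q]] by auto
  have "mat_norm Q x \<le> sqrt B * norm x" for x
  proof -
    have "x \<bullet> (Q *v x) \<le> norm x * (B * norm x)"
      by (meson B(2) mult_left_mono norm_cauchy_schwarz norm_ge_zero order_trans)
    then have "mat_norm Q x \<le> sqrt (B * (norm x)\<^sup>2)"
      by (simp add: mat_norm_def power2_eq_square ac_simps)
    then show ?thesis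
      by (simp add: real_sqrt_mult)
  qed
  with B(1) that[of "sqrt B"] show thesis by simp
qed

text \<open>Writing |x|^2 as the Q-product of x with Q^{-1} x, Cauchy-Schwarz for Q and boundedness
  of Q^{-1} give the bound after division by |x|; no eigenvalues enter.\<close>

lemma norm_le_mat_norm:
  assumes "pos_def Q"
  obtains c where "c > 0" "\<And>x. norm x \<le> c * mat_norm Q x"
proof -
  let ?P = "matrix_inv Q"
  have QP: "Q ** ?P = mat 1"
    using pos_def_invertible[OF assms] by (simp add: matrix_inv_mult)
  obtain c where c: "c > 0" "\<And>x. mat_norm Q x \<le> c * norm x"
    using mat_norm_le_norm[OF assms] by blast
  obtain B where B: "B > 0" "\<And>x. norm (?P *v x) \<le> B * norm x"
    using linear_bounded_pos[OF matrix_vector_mul_linear[of ?P]] by auto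
  have "norm x \<le> (c * B) * mat_norm Q x" for x
  proof (cases "x = 0")
    case False
    have "norm x * norm x = x \<bullet> (Q *v (?P *v x))"
      by (simp add: matrix_vector_mul_assoc QP dot_square_norm power2_eq_square)
    also have "\<dots> \<le> mat_norm Q x * mat_norm Q (?P *v x)"
      using assms by (rule mat_norm_Cauchy_Schwarz)
    also have "\<dots> \<le> mat_norm Q x * (c * (B * norm x))"
      using c B(2)[of x] by (intro mult_left_mono mat_norm_nonneg assms)
        (meson less_imp_le mult_left_mono order_trans)
    finally show ?thesis
      using False by (simp add: ac_simps)
  qed (use c B mat_norm_nonneg[OF assms] in simp)
  with c(1) B(1) that[of "c * B"] show thesis by simp
qed


section \<open>Contractions are exponentially input-to-state stable\<close>

text \<open>Iterating N(x_{k+1}) \<le> \<rho> N(x_k) + C s leaves a geometrically decaying term and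
  the geometric series C s / (1 - \<rho>). Hence the rate is - ln \<rho> and the gain is linear with
  slope \<open>g\<close>.\<close>

lemma exp_ISS_contraction:
  fixes N :: "'x::real_normed_vector \<Rightarrow> real"
  assumes triangle: "\<And>x y. N (x + y) \<le> N x + N y"
    and lower: "c > 0" "\<And>x. norm x \<le> c * N x"
    and upper: "C > 0" "\<And>x. N x \<le> C * norm x"
    and contr: "\<And>q x. q \<in> S \<Longrightarrow> N (f q x) \<le> \<rho> * N x"
    and \<rho>: "0 < \<rho>" "\<rho> < 1"
  shows "exp_ISS (\<lambda>q x w. f q x + w) S \<Omega>"
proof -
  define g where "g = c * C / (1 - \<rho>)"
  have g: "g > 0"
    using lower(1) upper(1) \<rho> by (simp add: g_def)
  have "norm (x k) \<le> (c * C) * exp (- (- ln \<rho>) * real k) * norm (x 0) + g * sup_norm_upto w k"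
    if p: "\<And>k. p k \<in> S" and x: "\<And>k. x (Suc k) = f (p k) (x k) + w k" for x p w k
  proof -
    define s where "s = sup_norm_upto w k"
    have ws: "norm (w i) \<le> s" if "i < k" for i
      using that unfolding s_def sup_norm_upto_def by (auto intro!: cSUP_upper)
    \<comment> \<open>For \<open>k = 0\<close> the supremum is 0 by convention; otherwise it
      dominates the norm of \<open>w 0\<close>.\<close>
    have s: "s \<ge> 0"
    proof (cases "k = 0")
      case False
      then show ?thesis using order_trans[OF norm_ge_zero ws[of 0]] by simp
    qed (simp add: s_def sup_norm_upto_def)
    \<comment> \<open>With \<open>k\<close> fixed, the induction stops at \<open>k\<close> because
      \<open>s\<close> bounds only earlier perturbations. The added constant is the fixed point of t
      \<mapsto> \<rho> t + C s.\<close>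
    have "N (x i) \<le> \<rho> ^ i * N (x 0) + C * s / (1 - \<rho>)" if "i \<le> k" for i
      using that
    proof (induction i)
      case 0
      then show ?case using s upper(1) \<rho> by simp
    next
      case (Suc i)
      have "N (x (Suc i)) \<le> N (f (p i) (x i)) + N (w i)"
        unfolding x by (rule triangle)
      also have "\<dots> \<le> \<rho> * N (x i) + C * s"
        using contr[OF p] upper ws[of i] Suc.prems
        by (intro add_mono) (auto intro: order_trans[OF upper(2)])
      also have "\<dots> \<le> \<rho> * (\<rho> ^ i * N (x 0) + C * s / (1 - \<rho>)) + C * s"
        using Suc \<rho> by simp
      also have "\<dots> = \<rho> ^ Suc i * N (x 0) + C * s / (1 - \<rho>)"
        using \<rho> by (simp add: field_simps)
      finally show ?case .
    qed
    then have "N (x k) \<le> \<rho> ^ k * N (x 0) + C * s / (1 - \<rho>)"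
      by simp
    also have "\<dots> \<le> \<rho> ^ k * (C * norm (x 0)) + C * s / (1 - \<rho>)"
      using \<rho> upper by simp
    finally have "c * N (x k) \<le> c * (\<rho> ^ k * (C * norm (x 0)) + C * s / (1 - \<rho>))"
      using lower(1) by simp
    moreover have "\<rho> ^ k = exp (- (- ln \<rho>) * real k)"
      using \<rho> by (simp add: exp_of_nat2_mult)
    ultimately show ?thesis
      using lower(2)[of "x k"] by (simp add: g_def s_def algebra_simps)
  qed
  moreover have "class_K ((*) g)"
    using g by (auto simp: class_K_def strict_mono_on_def intro!: continuous_intros)
  moreover have "c * C > 0" "- ln \<rho> > 0"
    using lower(1) upper(1) \<rho> by simp_all
  ultimately show ?thesis
    unfolding exp_ISS_def by blast
qed


section \<open>Removing the multiplier and the Kronecker structure\<close>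

definition lift :: "real^'l \<Rightarrow> real^'q \<Rightarrow> real^('q + 'l \<times> 'q)"
  where "lift q v = v \<Zsemi>\<^sub>v q \<otimes>\<^sub>v v"

lemma stacked_mult_vec: "(mat 1 \<Zsemi> (q \<otimes>\<^sub>c mat 1)) *v v = lift q v"
  by (simp add: vstack_mult_vec kron_col_mult_vec lift_def)

text \<open>The zero block annihilates the Kronecker component, so the blocks of \<Phi> built from
  \<Y>, its barred variant and \<E> reduce to ordinary forms in \<open>P\<close>, \<Delta> and the
  identity.\<close>

lemma inner_lift_blkdiag_0: "lift q v \<bullet> ((A \<oplus> 0) *v lift q v') = v \<bullet> (A *v v')"
  by (simp add: lift_def blkdiag_mult_vjoin inner_vjoin)

lemma transpose_lift: "transpose (A \<oplus> (mat 1 \<otimes> A)) *v lift q v = lift q (transpose A *v v)"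
  by (simp add: lift_def transpose_blkdiag blkdiag_mult_vjoin transpose_kron kron_mult_kron_vec)

text \<open>A full-block S-procedure: \<open>v\<close> is the output of the scheduling channel and
  \<open>\<eta>\<close> its feedback through \<open>Upsilon q\<close>. The first inequality bounds
  the \<Xi>-form at (v, \<eta>) by the \<Phi>-form at \<open>z\<close>, and the multiplier condition
  makes the former nonnegative.\<close>

lemma multiplier_relaxation:
  fixes q :: "real^'l" and \<Xi>11 \<Xi>12 \<Xi>22 :: "real^('l::finite \<times> 'n::finite, 'l \<times> 't::finite) five^('l \<times> 'n, 'l \<times> 't) five"
    and a b c d :: "real^'n" and e :: "real^'t"
  assumes lmi: "neg_def (transpose (((M11 \<parallel> M12) \<Zsemi> (mat 1 \<parallel> 0)) \<Zsemi> (M21 \<parallel> M22)) **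
                    (\<Xi> \<oplus> - \<Phi>) ** (((M11 \<parallel> M12) \<Zsemi> (mat 1 \<parallel> 0)) \<Zsemi> (M21 \<parallel> M22)))"
    and mult: "pos_semidef (transpose (mat 1 \<Zsemi> Upsilon q) ** \<Xi> ** (mat 1 \<Zsemi> Upsilon q))"
  defines "z \<equiv> lift q a \<Zsemi>\<^sub>v lift q b \<Zsemi>\<^sub>v lift q c \<Zsemi>\<^sub>v lift q d \<Zsemi>\<^sub>v lift q e"
  shows "0 \<le> z \<bullet> (\<Phi> *v z)"
proof -
  define \<zeta> where "\<zeta> = a \<Zsemi>\<^sub>v b \<Zsemi>\<^sub>v c \<Zsemi>\<^sub>v d \<Zsemi>\<^sub>v e"
  define v :: "real^('l \<times> 'n, 'l \<times> 't) five" where "v = M12 *v \<zeta>"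
  define \<eta> where "\<eta> = Upsilon q *v v"
  let ?N = "((M11 \<parallel> M12) \<Zsemi> (mat 1 \<parallel> 0)) \<Zsemi> (M21 \<parallel> M22)"
  \<comment> \<open>In each block, \<open>blk_R\<close> puts v on top and \<open>blk_L\<close> puts
    q \<otimes> v below, which assembles the lift.\<close>
  have z: "M21 *v \<eta> + M22 *v \<zeta> = z"
    by (simp add: \<eta>_def v_def \<zeta>_def z_def M12_def M21_def M22_def Upsilon_def blkdiag_mult_vjoin
        blk_E_def blk_L_def blk_R_def kron_col_mult_vec kron_mult_kron_vec Diag_mult_1
        vstack_mult_vec vjoin_add lift_def)
  have N: "?N *v (\<eta> \<Zsemi>\<^sub>v \<zeta>) = (v \<Zsemi>\<^sub>v \<eta>) \<Zsemi>\<^sub>v z"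
    by (simp add: vstack_mult_vec hstack_mult_vjoin z M11_def v_def)
  have "0 \<le> - ((\<eta> \<Zsemi>\<^sub>v \<zeta>) \<bullet> ((transpose ?N ** (\<Xi> \<oplus> - \<Phi>) ** ?N) *v (\<eta> \<Zsemi>\<^sub>v \<zeta>)))"
    using pos_def_nonneg[OF lmi[unfolded neg_def_def], of "\<eta> \<Zsemi>\<^sub>v \<zeta>"]
    by (simp only: uminus_mult_vec inner_minus_right)
  also have "\<dots> = z \<bullet> (\<Phi> *v z) - (v \<Zsemi>\<^sub>v \<eta>) \<bullet> (\<Xi> *v (v \<Zsemi>\<^sub>v \<eta>))"
    unfolding inner_congruence N by (simp add: blkdiag_mult_vjoin inner_vjoin uminus_mult_vec)
  finally have 1: "(v \<Zsemi>\<^sub>v \<eta>) \<bullet> (\<Xi> *v (v \<Zsemi>\<^sub>v \<eta>)) \<le> z \<bullet> (\<Phi> *v z)"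
    by simp
  have "0 \<le> v \<bullet> ((transpose (mat 1 \<Zsemi> Upsilon q) ** \<Xi> ** (mat 1 \<Zsemi> Upsilon q)) *v v)"
    using mult by (simp add: pos_semidef_def)
  also have "\<dots> = (v \<Zsemi>\<^sub>v \<eta>) \<bullet> (\<Xi> *v (v \<Zsemi>\<^sub>v \<eta>))"
    unfolding inner_congruence by (simp add: vstack_mult_vec \<eta>_def)
  finally show ?thesis
    using 1 by simp
qed

text \<open>Pairing \<open>FQ\<close> with two lifted vectors gives the form of \<open>H\<close>, by
  the factorization of \<open>H\<close>. Symmetric off-diagonal blocks account for the factors
  2.\<close>

lemma Phi_quadratic_form:
  fixes q :: "real^'l::finite" and a b c d :: "real^'n" and e :: "real^'t"
    and FQ :: "real^('n + 'l::finite \<times> 'n)^('t + 'l \<times> 't)"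
  assumes H: "H = transpose (mat 1 \<Zsemi> (q \<otimes>\<^sub>c mat 1)) ** FQ ** (mat 1 \<Zsemi> (q \<otimes>\<^sub>c mat 1))"
    and P: "transpose P = P"
  defines "z \<equiv> lift q a \<Zsemi>\<^sub>v lift q b \<Zsemi>\<^sub>v lift q c \<Zsemi>\<^sub>v lift q d \<Zsemi>\<^sub>v lift q e"
  shows "z \<bullet> (Phi P FQ Xplus \<Delta> \<epsilon> \<sigma> \<beta> *v z) =
    a \<bullet> (P *v a) + \<sigma> * (b \<bullet> (P *v b)) + c \<bullet> (P *v c) - \<epsilon> * (norm (transpose \<Delta> *v c))\<^sup>2
    + inverse \<beta> * (d \<bullet> (P *v d)) + \<epsilon> * (norm e)\<^sup>2
    + 2 * (c \<bullet> (Xplus *v (H *v a))) + 2 * (a \<bullet> (P *v d)) + 2 * (e \<bullet> (H *v a)) + 2 * (b \<bullet> (P *v c))"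
proof -
  have FQ: "lift q v \<bullet> (FQ *v lift q a) = v \<bullet> (H *v a)" for v
  proof -
    have "H *v a = transpose (mat 1 \<Zsemi> (q \<otimes>\<^sub>c mat 1)) *v (FQ *v lift q a)"
      by (simp only: H matrix_vector_mul_assoc[symmetric] stacked_mult_vec)
    then show ?thesis
      by (simp only: inner_transpose_mult stacked_mult_vec)
  qed
  have FQT: "lift q a \<bullet> (transpose FQ *v lift q e) = e \<bullet> (H *v a)"
    by (metis FQ inner_commute inner_transpose_mult)
  let ?XF = "(Xplus \<oplus> ((mat 1 :: real^'l^'l) \<otimes> Xplus)) ** FQ"
  have XF: "lift q c \<bullet> (?XF *v lift q a) = c \<bullet> (Xplus *v (H *v a))"
  proof -
    \<comment> \<open>Blkdiag(A, I \<otimes> A) maps lifts to lifts, so moving the transposed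
      \<open>Xplus\<close> block to the left leaves \<open>FQ\<close> between two lifted
      vectors.\<close>
    have "lift q c \<bullet> (?XF *v lift q a)
        = (transpose (Xplus \<oplus> ((mat 1 :: real^'l^'l) \<otimes> Xplus)) *v lift q c) \<bullet> (FQ *v lift q a)"
      by (metis inner_transpose_mult matrix_vector_mul_assoc transpose_transpose)
    also have "\<dots> = (transpose Xplus *v c) \<bullet> (H *v a)"
      by (simp only: transpose_lift FQ)
    finally show ?thesis
      by (metis inner_transpose_mult transpose_transpose)
  qed
  have XFT: "lift q a \<bullet> (transpose ?XF *v lift q c) = c \<bullet> (Xplus *v (H *v a))"
    by (metis XF inner_commute inner_transpose_mult)
  have sym: "x \<bullet> (P *v y) = y \<bullet> (P *v x)" for x y
    by (metis P inner_commute inner_transpose_mult)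
  have \<Delta>: "c \<bullet> ((\<Delta> ** transpose \<Delta>) *v c) = (norm (transpose \<Delta> *v c))\<^sup>2"
    by (metis inner_transpose_mult matrix_vector_mul_assoc power2_norm_eq_inner transpose_transpose)
  show ?thesis
    unfolding z_def Phi_def Let_def
    by (simp add: vstack_mult_vec hstack_mult_vjoin inner_vjoin inner_add_right inner_lift_blkdiag_0
        FQ FQT XF XFT \<Delta> scaleR_matrix_vector_assoc[symmetric] matrix_vector_mult_diff_rdistrib
        inner_diff_right sym[of d a] sym[of c b] power2_norm_eq_inner del: transpose_matrix_vector)
qed


section \<open>The closed loop in terms of the data\<close>

text \<open>The weights h = H a combine the samples into one virtual sample at scheduling value
  \<open>q\<close>, with state y = P a and input \<kappa> = K(q) y. The same combination of
  successors is therefore the closed-loop image of y plus W h.\<close>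

lemma data_closed_loop:
  fixes \<tau> :: "'t::finite \<Rightarrow> nat" and Ad :: "'l::finite \<Rightarrow> real^'n^'n"
    and F :: "real^('n + 'l \<times> 'n + 'l \<times> 'l \<times> 'n)^'t"
  assumes dyn: "\<And>j. x (Suc (\<tau> j)) = affine_mat Ad0 Ad (p (\<tau> j)) *v x (\<tau> j)
                  + affine_mat Bd0 Bd (p (\<tau> j)) *v u (\<tau> j) + w (\<tau> j)"
    and G: "G = data_mat \<tau> x \<Zsemi> data_mat \<tau> (\<lambda>k. p k \<otimes>\<^sub>v x k) \<Zsemi>
                data_mat \<tau> u \<Zsemi> data_mat \<tau> (\<lambda>k. p k \<otimes>\<^sub>v u k)"
    and N: "N_lin P Z0 Zbar = G ** F"
    and Z0: "Z0 = Kd0 ** P" and Zbar: "Zbar = hcat Kd ** (mat 1 \<otimes> P)"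
    and H: "H = F ** (mat 1 \<Zsemi> (q \<otimes>\<^sub>c mat 1) \<Zsemi> (q \<otimes>\<^sub>c q \<otimes>\<^sub>c mat 1))"
  shows "data_mat \<tau> (\<lambda>k. x (Suc k)) *v (H *v a) =
    (affine_mat Ad0 Ad q + affine_mat Bd0 Bd q ** affine_mat Kd0 Kd q) *v (P *v a)
    + data_mat \<tau> w *v (H *v a)"
proof -
  define h where "h = H *v a"
  define y where "y = P *v a"
  define \<kappa> where "\<kappa> = affine_mat Kd0 Kd q *v y"
  have Z: "Z0 *v a + Zbar *v (q \<otimes>\<^sub>v a) = \<kappa>"
    by (simp add: Z0 Zbar \<kappa>_def y_def affine_mat_mult_vec matrix_vector_mul_assoc[symmetric]
        kron_mult_kron_vec)
  have "G *v h = N_lin P Z0 Zbar *v (a \<Zsemi>\<^sub>v q \<otimes>\<^sub>v a \<Zsemi>\<^sub>v q \<otimes>\<^sub>v q \<otimes>\<^sub>v a)"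
    by (simp add: N h_def H matrix_vector_mul_assoc[symmetric] vstack_mult_vec kron_col_mult_vec)
  \<comment> \<open>The third block row yields \<kappa>; the last is the same computation tensored
    with \<open>q\<close>.\<close>
  also have "\<dots> = y \<Zsemi>\<^sub>v q \<otimes>\<^sub>v y \<Zsemi>\<^sub>v \<kappa> \<Zsemi>\<^sub>v q \<otimes>\<^sub>v \<kappa>"
    by (simp add: N_lin_def vstack_mult_vec hstack_mult_vjoin kron_mult_kron_vec y_def Z
        kron_vec_add[symmetric])
  finally have Gh: "data_mat \<tau> x *v h = y" "data_mat \<tau> (\<lambda>k. p k \<otimes>\<^sub>v x k) *v h = q \<otimes>\<^sub>v y"
      "data_mat \<tau> u *v h = \<kappa>" "data_mat \<tau> (\<lambda>k. p k \<otimes>\<^sub>v u k) *v h = q \<otimes>\<^sub>v \<kappa>"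
    by (simp_all add: G vstack_mult_vec vjoin_eq_iff)
  have "data_mat \<tau> (\<lambda>k. x (Suc k)) *v h =
      Ad0 *v (data_mat \<tau> x *v h) + hcat Ad *v (data_mat \<tau> (\<lambda>k. p k \<otimes>\<^sub>v x k) *v h)
      + (Bd0 *v (data_mat \<tau> u *v h) + hcat Bd *v (data_mat \<tau> (\<lambda>k. p k \<otimes>\<^sub>v u k) *v h))
      + data_mat \<tau> w *v h"
    unfolding mult_data_mat
    by (simp add: data_mat_mult_vec dyn affine_mat_mult_vec scaleR_add_right sum.distrib)
  also have "\<dots> = affine_mat Ad0 Ad q *v y + affine_mat Bd0 Bd q *v \<kappa> + data_mat \<tau> w *v h"
    unfolding Gh affine_mat_mult_vec by simp
  finally show ?thesis
    by (simp add: h_def y_def \<kappa>_def matrix_vector_mult_add_rdistrib matrix_vector_mul_assoc[symmetric])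
qed

text \<open>The form is evaluated at \<open>a = P\<inverse> x\<close>, \<open>d = - \<beta> a\<close>, \<open>c = - P\<inverse> A x / r\<close> with \<open>r = 1 - 1 / \<sigma>\<close>, and
  \<open>b = - c / \<sigma>\<close>; these minimize it over \<open>b\<close>, \<open>d\<close> and then \<open>c\<close>.\<close>

lemma contraction_of_quadratic_form:
  fixes A P :: "real^'n^'n"
  assumes P: "pos_def P" and \<sigma>: "\<sigma> > 1" and \<beta>: "0 < \<beta>" "\<beta> < 1"
    and form: "\<And>a b c d. 0 \<le> a \<bullet> (P *v a) + \<sigma> * (b \<bullet> (P *v b)) + c \<bullet> (P *v c) + inverse \<beta> * (d \<bullet> (P *v d))
      + 2 * (c \<bullet> (A *v (P *v a))) + 2 * (a \<bullet> (P *v d)) + 2 * (b \<bullet> (P *v c))"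
  shows "mat_norm (matrix_inv P) (A *v x) \<le> sqrt ((1 - \<beta>) * (1 - 1 / \<sigma>)) * mat_norm (matrix_inv P) x"
proof -
  let ?Q = "matrix_inv P"
  have Q: "pos_def ?Q"
    using P by (rule pos_def_matrix_inv)
  have PQ: "P *v (?Q *v y) = y" for y
    using pos_def_invertible[OF P] by (simp add: matrix_vector_mul_assoc matrix_inv_mult)
  define r where "r = 1 - 1 / \<sigma>"
  have r: "0 < r" and \<sigma>r: "1 / \<sigma> = 1 - r"
    using \<sigma> by (simp_all add: r_def)
  define V where "V y = y \<bullet> (?Q *v y)" for y
  have V: "(?Q *v y) \<bullet> y = V y" for y
    by (simp add: V_def inner_commute)
  let ?a = "?Q *v x" and ?y = "?Q *v (A *v x)"
  \<comment> \<open>Taking \<open>d\<close> parallel to \<open>a\<close>, and \<open>b\<close>,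
    \<open>c\<close> parallel to \<open>?y\<close>, reduces every term to a multiple of V(x) or V(A
    x), leaving three scalars to choose.\<close>
  have "0 \<le> (1 + inverse \<beta> * u\<^sup>2 + 2 * u) * V x + ((\<sigma> * t\<^sup>2 + 1 + 2 * t) * s\<^sup>2 + 2 * s) * V (A *v x)"
    for s t u
    using form[of ?a "(t * s) *\<^sub>R ?y" "s *\<^sub>R ?y" "u *\<^sub>R ?a"]
    by (simp add: matrix_vector_mult_scaleR PQ V algebra_simps power2_eq_square)
  from this[of "- \<beta>" "- 1 / \<sigma>" "- 1 / r"]
  moreover have "1 + inverse \<beta> * (- \<beta>)\<^sup>2 + 2 * (- \<beta>) = 1 - \<beta>"
    using \<beta> by (simp add: field_simps power2_eq_square)
  moreover have "\<sigma> * (- 1 / \<sigma>)\<^sup>2 + 1 + 2 * (- 1 / \<sigma>) = 1 - 1 / \<sigma>"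
    using \<sigma> by (simp add: field_simps power2_eq_square)
  ultimately
  have "0 \<le> (1 - \<beta>) * V x + ((1 - 1 / \<sigma>) * (- 1 / r)\<^sup>2 + 2 * (- 1 / r)) * V (A *v x)"
    by metis
  also have "(1 - 1 / \<sigma>) * (- 1 / r)\<^sup>2 + 2 * (- 1 / r) = - 1 / r"
    using r by (simp add: \<sigma>r power2_eq_square)
  finally have "V (A *v x) / r \<le> (1 - \<beta>) * V x"
    by simp
  then have "V (A *v x) \<le> ((1 - \<beta>) * r) * V x"
    using r by (simp add: field_simps)
  then have "sqrt (V (A *v x)) \<le> sqrt (((1 - \<beta>) * r) * V x)"
    by simp
  then show ?thesis
    by (simp add: mat_norm_def V_def r_def real_sqrt_mult)
qed

section \<open>Contraction and stability of the closed loop\<close>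

theorem theorem2:
  fixes Ad0 :: "real^'n^'n" and Ad :: "'l::finite \<Rightarrow> real^'n^'n"
    and Bd0 :: "real^'m^'n" and Bd :: "'l \<Rightarrow> real^'m^'n"
    and Pset :: "(real^'l) set" and \<delta> :: real
    and \<tau> :: "'t::finite \<Rightarrow> nat"
    and x w :: "nat \<Rightarrow> real^'n" and u :: "nat \<Rightarrow> real^'m" and p :: "nat \<Rightarrow> real^'l"
    and X Xplus :: "real^'t^'n" and XP :: "real^'t^('l \<times> 'n)"
    and U :: "real^'t^'m" and UP :: "real^'t^('l \<times> 'm)"
    and G :: "real^'t^('n + 'l \<times> 'n + 'm + 'l \<times> 'm)"
    and \<Delta> :: "real^'n^'n"
    and \<epsilon>1 \<sigma> \<beta>1 :: real
    and P :: "real^'n^'n" and Z0 :: "real^'n^'m" and Zbar :: "real^('l \<times> 'n)^'m"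
    and \<Xi>11 \<Xi>12 \<Xi>22 :: "real^('l \<times> 'n, 'l \<times> 't) five^('l \<times> 'n, 'l \<times> 't) five"
    and \<Xi> :: "real^(('l \<times> 'n, 'l \<times> 't) five + ('l \<times> 'n, 'l \<times> 't) five)
                  ^(('l \<times> 'n, 'l \<times> 't) five + ('l \<times> 'n, 'l \<times> 't) five)"
    and F :: "real^('n + 'l \<times> 'n + 'l \<times> 'l \<times> 'n)^'t"
    and FQ :: "real^('n + 'l \<times> 'n)^('t + 'l \<times> 't)"
    and Kd0 :: "real^'n^'m" and Kd :: "'l \<Rightarrow> real^'n^'m"
  assumes "polytope Pset" and "\<delta> > 0"
    and "bij_betw \<tau> UNIV {..<CARD('t)}"
    and "\<forall>k<CARD('t). x (Suc k) =
           affine_mat Ad0 Ad (p k) *v x k + affine_mat Bd0 Bd (p k) *v u k + w k"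
    and "\<forall>k\<le>CARD('t). p k \<in> Pset" and "\<forall>k\<le>CARD('t). norm (w k) \<le> \<delta>"
    and "U = data_mat \<tau> u" and "UP = data_mat \<tau> (\<lambda>k. p k \<otimes>\<^sub>v u k)"
    and "X = data_mat \<tau> x" and "XP = data_mat \<tau> (\<lambda>k. p k \<otimes>\<^sub>v x k)"
    and "Xplus = data_mat \<tau> (\<lambda>k. x (Suc k))"
    and "G = X \<Zsemi> XP \<Zsemi> U \<Zsemi> UP"
    and "\<Delta> = (sqrt (real CARD('t)) * \<delta>) *\<^sub>R mat 1"
    and "\<epsilon>1 > 0" and "\<sigma> > 1" and "0 < \<beta>1" and "\<beta>1 < 1"
    and "pos_def P"
    and "\<Xi> = (\<Xi>11 \<parallel> \<Xi>12) \<Zsemi> (transpose \<Xi>12 \<parallel> \<Xi>22)" and "transpose \<Xi> = \<Xi>"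
    and "\<forall>q\<in>Pset. F ** (mat 1 \<Zsemi> (q \<otimes>\<^sub>c mat 1) \<Zsemi> (q \<otimes>\<^sub>c q \<otimes>\<^sub>c mat 1)) =
           transpose (mat 1 \<Zsemi> (q \<otimes>\<^sub>c mat 1)) ** FQ ** (mat 1 \<Zsemi> (q \<otimes>\<^sub>c mat 1))"
    and "Kd0 = Z0 ** matrix_inv P"
    and "hcat Kd = Zbar ** matrix_inv (mat 1 \<otimes> P)"
    and "N_cl Kd0 (hcat Kd) ** (P \<oplus> (mat 1 \<otimes> P) \<oplus> (mat 1 \<otimes> mat 1 \<otimes> P)) = G ** F"
    and "\<forall>q\<in>Pset.
           neg_def (transpose (((M11 \<parallel> M12) \<Zsemi> (mat 1 \<parallel> 0)) \<Zsemi> (M21 \<parallel> M22)) **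
                    (\<Xi> \<oplus> - Phi P FQ Xplus \<Delta> \<epsilon>1 \<sigma> \<beta>1) **
                    (((M11 \<parallel> M12) \<Zsemi> (mat 1 \<parallel> 0)) \<Zsemi> (M21 \<parallel> M22))) \<and>
           pos_semidef (transpose (mat 1 \<Zsemi> Upsilon q) ** \<Xi> ** (mat 1 \<Zsemi> Upsilon q)) \<and>
           neg_def \<Xi>22 \<and>
           N_lin P Z0 Zbar = G ** F"
  shows "exp_ISS
           (\<lambda>q \<xi> \<omega>. (affine_mat Ad0 Ad q + affine_mat Bd0 Bd q ** affine_mat Kd0 Kd q) *v \<xi> + \<omega>)
           Pset (cball 0 \<delta>)"
proof -
  have \<tau>: "\<tau> j < CARD('t)" for j
    using assms(3) by (auto simp: bij_betw_def)
  have dyn: "x (Suc (\<tau> j)) = affine_mat Ad0 Ad (p (\<tau> j)) *v x (\<tau> j)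
      + affine_mat Bd0 Bd (p (\<tau> j)) *v u (\<tau> j) + w (\<tau> j)" for j
    using assms(4) \<tau> by blast
  have w: "norm (w (\<tau> j)) \<le> \<delta>" for j
    using assms(6) \<tau> less_imp_le by blast
  note P = \<open>pos_def P\<close>
  have G: "G = data_mat \<tau> x \<Zsemi> data_mat \<tau> (\<lambda>k. p k \<otimes>\<^sub>v x k) \<Zsemi>
      data_mat \<tau> u \<Zsemi> data_mat \<tau> (\<lambda>k. p k \<otimes>\<^sub>v u k)"
    using assms(7-10,12) by simp
  have P_inv: "matrix_inv P ** P = mat 1" "P ** matrix_inv P = mat 1"
    using pos_def_invertible[OF P] by (simp_all add: matrix_inv_mult)
  have Z0: "Z0 = Kd0 ** P"
    by (metis \<open>Kd0 = Z0 ** matrix_inv P\<close> matrix_mul_assoc matrix_mul_rid P_inv(1))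
  \<comment> \<open>The inverse is I \<otimes> P^{-1}; it allows the formula for the gains to be
    solved for \<open>Zbar\<close>.\<close>
  have "invertible ((mat 1 :: real^'l^'l) \<otimes> P)"
    unfolding invertible_def by (rule exI[of _ "mat 1 \<otimes> matrix_inv P"])
      (simp add: kron_mult_kron P_inv kron_mat_1)
  then have Zbar: "Zbar = hcat Kd ** (mat 1 \<otimes> P)"
    by (metis \<open>hcat Kd = _\<close> matrix_mul_assoc matrix_mul_rid matrix_inv_mult(2))
  let ?A = "\<lambda>q. affine_mat Ad0 Ad q + affine_mat Bd0 Bd q ** affine_mat Kd0 Kd q"
  define \<rho> where "\<rho> = sqrt ((1 - \<beta>1) * (1 - 1 / \<sigma>))"
  have contr: "mat_norm (matrix_inv P) (?A q *v y) \<le> \<rho> * mat_norm (matrix_inv P) y"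
    if q: "q \<in> Pset" for q y
    unfolding \<rho>_def
  proof (rule contraction_of_quadratic_form[OF P \<open>\<sigma> > 1\<close> \<open>0 < \<beta>1\<close> \<open>\<beta>1 < 1\<close>])
    fix a b c d :: "real^'n"
    define H where "H = F ** (mat 1 \<Zsemi> (q \<otimes>\<^sub>c mat 1) \<Zsemi> (q \<otimes>\<^sub>c q \<otimes>\<^sub>c mat 1))"
    have H': "H = transpose (mat 1 \<Zsemi> (q \<otimes>\<^sub>c mat 1)) ** FQ ** (mat 1 \<Zsemi> (q \<otimes>\<^sub>c mat 1))"
      unfolding H_def using assms(21) q by blast
    let ?W = "data_mat \<tau> w"
    \<comment> \<open>With this choice the cross terms 2 c^T W H a and 2 e^T H a cancel, and the
      unknown W survives only in \<epsilon>1 (|W^T c|^2 - |\<Delta>^T c|^2), which is at most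
      0.\<close>
    let ?e = "- (transpose ?W *v c)"
    let ?z = "lift q a \<Zsemi>\<^sub>v lift q b \<Zsemi>\<^sub>v lift q c \<Zsemi>\<^sub>v lift q d \<Zsemi>\<^sub>v lift q ?e"
    have lmi: "neg_def (transpose (((M11 \<parallel> M12) \<Zsemi> (mat 1 \<parallel> 0)) \<Zsemi> (M21 \<parallel> M22)) **
          (\<Xi> \<oplus> - Phi P FQ Xplus \<Delta> \<epsilon>1 \<sigma> \<beta>1) **
          (((M11 \<parallel> M12) \<Zsemi> (mat 1 \<parallel> 0)) \<Zsemi> (M21 \<parallel> M22)))"
      and mult: "pos_semidef (transpose (mat 1 \<Zsemi> Upsilon q) ** \<Xi> ** (mat 1 \<Zsemi> Upsilon q))"
      and N: "N_lin P Z0 Zbar = G ** F"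
      using assms(25) q by blast+
    have "0 \<le> ?z \<bullet> (Phi P FQ Xplus \<Delta> \<epsilon>1 \<sigma> \<beta>1 *v ?z)"
      using lmi mult by (rule multiplier_relaxation)
    also have "\<dots> = a \<bullet> (P *v a) + \<sigma> * (b \<bullet> (P *v b)) + c \<bullet> (P *v c)
        - \<epsilon>1 * (norm (transpose \<Delta> *v c))\<^sup>2 + inverse \<beta>1 * (d \<bullet> (P *v d)) + \<epsilon>1 * (norm ?e)\<^sup>2
        + 2 * (c \<bullet> (Xplus *v (H *v a))) + 2 * (a \<bullet> (P *v d)) + 2 * (?e \<bullet> (H *v a)) + 2 * (b \<bullet> (P *v c))"
      using P by (intro Phi_quadratic_form[OF H']) (simp add: pos_def_def)
    also have "Xplus *v (H *v a) = ?A q *v (P *v a) + ?W *v (H *v a)"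
      unfolding \<open>Xplus = _\<close> by (rule data_closed_loop[OF dyn G N Z0 Zbar H_def])
    also have "c \<bullet> (?A q *v (P *v a) + ?W *v (H *v a)) = c \<bullet> (?A q *v (P *v a)) - ?e \<bullet> (H *v a)"
      using inner_transpose_mult[of "H *v a" ?W c]
      by (simp add: inner_add_right inner_commute del: transpose_matrix_vector)
    finally have form: "0 \<le> a \<bullet> (P *v a) + \<sigma> * (b \<bullet> (P *v b)) + c \<bullet> (P *v c)
        + \<epsilon>1 * ((norm ?e)\<^sup>2 - (norm (transpose \<Delta> *v c))\<^sup>2) + inverse \<beta>1 * (d \<bullet> (P *v d))
        + 2 * (c \<bullet> (?A q *v (P *v a))) + 2 * (a \<bullet> (P *v d)) + 2 * (b \<bullet> (P *v c))"
      by (simp add: algebra_simps)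
    have "transpose \<Delta> *v c = (sqrt (real CARD('t)) * \<delta>) *\<^sub>R c"
      unfolding \<open>\<Delta> = _\<close> transpose_scalar transpose_mat scaleR_matrix_vector_assoc[symmetric] by simp
    then have "(norm ?e)\<^sup>2 \<le> (norm (transpose \<Delta> *v c))\<^sup>2"
      using norm_transpose_data_mat_le[of w \<tau> \<delta> c] w
      by (simp add: power_mult_distrib del: transpose_matrix_vector)
    then have "\<epsilon>1 * ((norm ?e)\<^sup>2 - (norm (transpose \<Delta> *v c))\<^sup>2) \<le> 0"
      using \<open>\<epsilon>1 > 0\<close> by (simp add: mult_le_0_iff)
    with form show "0 \<le> a \<bullet> (P *v a) + \<sigma> * (b \<bullet> (P *v b)) + c \<bullet> (P *v c) + inverse \<beta>1 * (d \<bullet> (P *v d))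
        + 2 * (c \<bullet> (?A q *v (P *v a))) + 2 * (a \<bullet> (P *v d)) + 2 * (b \<bullet> (P *v c))"
      by linarith
  qed
  have Q: "pos_def (matrix_inv P)"
    using P by (rule pos_def_matrix_inv)
  obtain C where C: "C > 0" "\<And>y. mat_norm (matrix_inv P) y \<le> C * norm y"
    using mat_norm_le_norm[OF Q] by blast
  obtain c where c: "c > 0" "\<And>y. norm y \<le> c * mat_norm (matrix_inv P) y"
    using norm_le_mat_norm[OF Q] by blast
  \<comment> \<open>Besides \<rho> < 1, positivity is required because the decay rate is - ln
    \<rho>.\<close>
  have "0 < (1 - \<beta>1) * (1 - 1 / \<sigma>)"
    using \<open>\<sigma> > 1\<close> \<open>\<beta>1 < 1\<close> by simp
  moreover have "(1 - \<beta>1) * (1 - 1 / \<sigma>) < 1 * 1"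
    using \<open>\<sigma> > 1\<close> \<open>0 < \<beta>1\<close> \<open>\<beta>1 < 1\<close> by (intro mult_strict_mono) simp_all
  ultimately have "0 < \<rho>" "\<rho> < 1"
    by (simp_all add: \<rho>_def)
  with mat_norm_triangle[OF Q] c C contr show ?thesis
    by (rule exp_ISS_contraction)
qed

end
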